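(* Let $T : \mathrm{Hol}(\mathbb{A}) \to \mathrm{Hol}(\mathbb{A})$ be a linear and continuous operator such that for all $f \in \mathrm{Hol}(\mathbb{A})$ and all $n \in \mathbb{N}$, $$\|T(f)\|_{\infty,n} = \|f\|_{\infty,n}.$$ Then there exist two constants $\alpha, \beta \in \mathbb{T}$ such that $T = T_{\alpha,\beta}$ or $T = S_{\alpha,\beta}$, where for all $f \in \mathrm{Hol}(\mathbb{A})$ and $z \in \mathbb{A}$, $$T_{\alpha,\beta}(f)(z) = \alpha f(\beta z), \qquad S_{\alpha,\beta}(f)(z) = \alpha f(\beta/z).$$
   Context: Fix a real number $R > 1$ and let $\mathbb{A} = \{z \in \mathbb{C} : 1/R < |z| < R\}$. $\mathrm{Hol}(\mathbb{A})$ is the Fréchet space of holomorphic functions $\mathbb{A} \to \mathbb{C}$ with the topology of uniform convergence on compact subsets of $\mathbb{A}$. $\mathbb{T}$ is the unit circle of $\mathbb{C}$, and $\mathbb{N} = \{1,2,3,\dots\}$. For $n \in \mathbb{N}$, $K_n = \{z \in \mathbb{C} : R^{\frac1n - 1} \le |z| \le R^{1-\frac1n}\}$ (so $K_1 = \mathbb{T}$) and $\|f\|_{\infty,n} := \sup_{z \in K_n} |f(z)|$. *)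

theory Defs
  imports "HOL-Complex_Analysis.Complex_Analysis"
begin

definition annulus :: "real \<Rightarrow> complex set" where
  "annulus R = {z. 1 / R < cmod z \<and> cmod z < R}"

text \<open>HOL functions are total, so a map from the annulus to the complex numbers is represented by
  its extension by zero. Equality of such functions is then equality on the annulus, and the set is
  closed under the pointwise linear operations.\<close>

definition Hol :: "real \<Rightarrow> (complex \<Rightarrow> complex) set" where
  "Hol R = {f. f holomorphic_on annulus R \<and> (\<forall>z. z \<notin> annulus R \<longrightarrow> f z = 0)}"

definition Hol_nbhd ::
  "real \<Rightarrow> (complex \<Rightarrow> complex) \<Rightarrow> complex set \<Rightarrow> real \<Rightarrow> (complex \<Rightarrow> complex) set" where
  "Hol_nbhd R f K e = {g \<in> Hol R. \<forall>z\<in>K. dist (g z) (f z) < e}"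

definition Hol_open :: "real \<Rightarrow> (complex \<Rightarrow> complex) set \<Rightarrow> bool" where
  "Hol_open R U \<longleftrightarrow> U \<subseteq> Hol R \<and>
     (\<forall>f\<in>U. \<exists>K e. compact K \<and> K \<subseteq> annulus R \<and> e > 0 \<and> Hol_nbhd R f K e \<subseteq> U)"

definition Hol_topology :: "real \<Rightarrow> (complex \<Rightarrow> complex) topology" where
  "Hol_topology R = topology (Hol_open R)"

lemma istopology_Hol_open: "istopology (Hol_open R)"
  unfolding istopology_def
proof (intro conjI allI impI)
  fix S T
  assume S: "Hol_open R S" and T: "Hol_open R T"
  show "Hol_open R (S \<inter> T)"
    unfolding Hol_open_def
  proof (intro conjI ballI)
    show "S \<inter> T \<subseteq> Hol R" using S by (auto simp: Hol_open_def)
    fix f assume f: "f \<in> S \<inter> T"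
    obtain K e where K: "compact K" "K \<subseteq> annulus R" "e > 0" "Hol_nbhd R f K e \<subseteq> S"
      using S f unfolding Hol_open_def by blast
    obtain L d where L: "compact L" "L \<subseteq> annulus R" "d > 0" "Hol_nbhd R f L d \<subseteq> T"
      using T f unfolding Hol_open_def by blast
    have "Hol_nbhd R f (K \<union> L) (min e d) \<subseteq> Hol_nbhd R f K e \<inter> Hol_nbhd R f L d"
      by (auto simp: Hol_nbhd_def)
    with K L show "\<exists>K e. compact K \<and> K \<subseteq> annulus R \<and> e > 0 \<and> Hol_nbhd R f K e \<subseteq> S \<inter> T"
      by (intro exI[of _ "K \<union> L"] exI[of _ "min e d"]) auto
  qed
next
  fix \<K> assume *: "\<forall>K\<in>\<K>. Hol_open R K"
  show "Hol_open R (\<Union>\<K>)"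
    unfolding Hol_open_def
  proof (intro conjI ballI)
    show "\<Union>\<K> \<subseteq> Hol R" using * by (auto simp: Hol_open_def)
    fix f assume "f \<in> \<Union>\<K>"
    then obtain U where U: "U \<in> \<K>" "f \<in> U" by blast
    then obtain K e where "compact K" "K \<subseteq> annulus R" "e > 0" "Hol_nbhd R f K e \<subseteq> U"
      using * unfolding Hol_open_def by meson
    with U show "\<exists>K e. compact K \<and> K \<subseteq> annulus R \<and> e > 0 \<and> Hol_nbhd R f K e \<subseteq> \<Union>\<K>"
      by blast
  qed
qed

lemma openin_Hol_topology: "openin (Hol_topology R) U \<longleftrightarrow> Hol_open R U"
  by (simp add: Hol_topology_def istopology_Hol_open)

lemma topspace_Hol_topology [simp]: "topspace (Hol_topology R) = Hol R"
proof -
  have "Hol_open R (Hol R)"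
    unfolding Hol_open_def Hol_nbhd_def
    by (auto intro!: exI[of _ "{}"] exI[of _ "1::real"])
  then show ?thesis
    unfolding topspace_def openin_Hol_topology by (auto simp: Hol_open_def)
qed

lemma openin_Hol_nbhd:
  assumes f: "f \<in> Hol R" and K: "compact K" "K \<subseteq> annulus R"
  shows "openin (Hol_topology R) (Hol_nbhd R f K e)"
  unfolding openin_Hol_topology Hol_open_def
proof (intro conjI ballI)
  show "Hol_nbhd R f K e \<subseteq> Hol R" by (auto simp: Hol_nbhd_def)
  fix g assume g: "g \<in> Hol_nbhd R f K e"
  have "continuous_on K f" "continuous_on K g"
    using f g K by (auto simp: Hol_def Hol_nbhd_def
        intro: holomorphic_on_imp_continuous_on continuous_on_subset)
  then have cont: "continuous_on K (\<lambda>z. dist (g z) (f z))" by (intro continuous_intros)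
  have "\<exists>d>0. \<forall>z\<in>K. dist (g z) (f z) + d \<le> e"
  proof (cases "K = {}")
    case True
    then show ?thesis by (auto intro: exI[of _ 1])
  next
    case False
    then obtain w where w: "w \<in> K" "\<forall>z\<in>K. dist (g z) (f z) \<le> dist (g w) (f w)"
      using continuous_attains_sup[OF K(1) False cont] by blast
    with g have "dist (g w) (f w) < e" by (simp add: Hol_nbhd_def)
    with w(2) show ?thesis by (intro exI[of _ "e - dist (g w) (f w)"]) auto
  qed
  then obtain d where d: "d > 0" "\<forall>z\<in>K. dist (g z) (f z) + d \<le> e" by blast
  have "Hol_nbhd R g K d \<subseteq> Hol_nbhd R f K e"
  proof
    fix h assume h: "h \<in> Hol_nbhd R g K d"
    have "dist (h z) (f z) < e" if "z \<in> K" for z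
    proof -
      have "dist (h z) (g z) < d" "dist (g z) (f z) + d \<le> e"
        using h d that by (auto simp: Hol_nbhd_def)
      then show ?thesis using dist_triangle[of "h z" "f z" "g z"] by linarith
    qed
    with h show "h \<in> Hol_nbhd R f K e" by (auto simp: Hol_nbhd_def)
  qed
  with K d show "\<exists>L e'. compact L \<and> L \<subseteq> annulus R \<and> e' > 0 \<and> Hol_nbhd R g L e' \<subseteq> Hol_nbhd R f K e"
    by blast
qed

lemma limitin_Hol_topology_iff:
  assumes F: "\<And>i. F i \<in> Hol R"
  shows "limitin (Hol_topology R) F f \<F> \<longleftrightarrow>
    f \<in> Hol R \<and> (\<forall>K. compact K \<and> K \<subseteq> annulus R \<longrightarrow> uniform_limit K F f \<F>)" (is "?L \<longleftrightarrow> ?Q")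
proof
  assume L: ?L
  then have f: "f \<in> Hol R" by (simp add: limitin_def)
  show ?Q
  proof (intro conjI allI impI f uniform_limitI)
    fix K and e :: real
    assume K: "compact K \<and> K \<subseteq> annulus R" and e: "0 < e"
    have "f \<in> Hol_nbhd R f K e" using f e by (simp add: Hol_nbhd_def)
    then have "\<forall>\<^sub>F i in \<F>. F i \<in> Hol_nbhd R f K e"
      using L openin_Hol_nbhd[OF f] K by (simp add: limitin_def)
    then show "\<forall>\<^sub>F i in \<F>. \<forall>z\<in>K. dist (F i z) (f z) < e"
      by eventually_elim (auto simp: Hol_nbhd_def)
  qed
next
  assume Q: ?Q
  show ?L
    unfolding limitin_def topspace_Hol_topology
  proof (intro conjI allI impI)
    show "f \<in> Hol R" using Q by blast
    fix U assume "openin (Hol_topology R) U \<and> f \<in> U"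
    then obtain K e where K: "compact K" "K \<subseteq> annulus R" "e > 0" "Hol_nbhd R f K e \<subseteq> U"
      unfolding openin_Hol_topology Hol_open_def by blast
    then have "\<forall>\<^sub>F i in \<F>. \<forall>z\<in>K. dist (F i z) (f z) < e"
      using Q by (auto dest: uniform_limitD)
    then show "\<forall>\<^sub>F i in \<F>. F i \<in> U"
      by eventually_elim (use K F in \<open>auto simp: Hol_nbhd_def\<close>)
  qed
qed

definition Hol_linear ::
  "real \<Rightarrow> ((complex \<Rightarrow> complex) \<Rightarrow> (complex \<Rightarrow> complex)) \<Rightarrow> bool" where
  "Hol_linear R T \<longleftrightarrow>
     (\<forall>f\<in>Hol R. \<forall>g\<in>Hol R. T (\<lambda>z. f z + g z) = (\<lambda>z. T f z + T g z)) \<and>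
     (\<forall>c. \<forall>f\<in>Hol R. T (\<lambda>z. c * f z) = (\<lambda>z. c * T f z))"

definition K_ann :: "real \<Rightarrow> nat \<Rightarrow> complex set" where
  "K_ann R n = {z. R powr (1 / real n - 1) \<le> cmod z \<and> cmod z \<le> R powr (1 - 1 / real n)}"

definition sup_norm :: "real \<Rightarrow> nat \<Rightarrow> (complex \<Rightarrow> complex) \<Rightarrow> real" where
  "sup_norm R n f = (SUP z\<in>K_ann R n. cmod (f z))"

text \<open>No case distinction is needed off the annulus: for \<open>cmod \<beta> = 1\<close> both
  substitutions preserve the annulus and its complement (with \<open>\<beta> / 0 = 0\<close>), so the zero
  extension is preserved, as the lemmas below record.\<close>

definition T_op :: "complex \<Rightarrow> complex \<Rightarrow> (complex \<Rightarrow> complex) \<Rightarrow> (complex \<Rightarrow> complex)" where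
  "T_op \<alpha> \<beta> f = (\<lambda>z. \<alpha> * f (\<beta> * z))"

definition S_op :: "complex \<Rightarrow> complex \<Rightarrow> (complex \<Rightarrow> complex) \<Rightarrow> (complex \<Rightarrow> complex)" where
  "S_op \<alpha> \<beta> f = (\<lambda>z. \<alpha> * f (\<beta> / z))"

lemma annulus_mult_iff: "cmod \<beta> = 1 \<Longrightarrow> \<beta> * z \<in> annulus R \<longleftrightarrow> z \<in> annulus R"
  by (simp add: annulus_def norm_mult)

lemma annulus_divide_iff:
  assumes "R > 1" "cmod \<beta> = 1"
  shows "\<beta> / z \<in> annulus R \<longleftrightarrow> z \<in> annulus R"
proof (cases "z = 0")
  case False
  then show ?thesis
    using assms by (auto simp: annulus_def norm_divide field_simps)
qed (use assms in \<open>auto simp: annulus_def\<close>)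

lemma T_op_in_Hol:
  assumes "cmod \<beta> = 1" "f \<in> Hol R"
  shows "T_op \<alpha> \<beta> f \<in> Hol R"
proof -
  have "(f \<circ> (\<lambda>z. \<beta> * z)) holomorphic_on annulus R"
    using assms by (intro holomorphic_on_compose_gen[where t = "annulus R"] holomorphic_intros)
      (auto simp: Hol_def annulus_mult_iff)
  with assms show ?thesis
    by (auto simp: Hol_def T_op_def o_def annulus_mult_iff intro!: holomorphic_intros)
qed

lemma S_op_in_Hol:
  assumes "R > 1" "cmod \<beta> = 1" "f \<in> Hol R"
  shows "S_op \<alpha> \<beta> f \<in> Hol R"
proof -
  have "z \<noteq> 0" if "z \<in> annulus R" for z using that assms(1) by (auto simp: annulus_def)
  then have "(f \<circ> (\<lambda>z. \<beta> / z)) holomorphic_on annulus R"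
    using assms by (intro holomorphic_on_compose_gen[where t = "annulus R"] holomorphic_intros)
      (auto simp: Hol_def annulus_divide_iff)
  with assms show ?thesis
    by (auto simp: Hol_def S_op_def o_def annulus_divide_iff intro!: holomorphic_intros)
qed

lemma K_ann_1: "R > 1 \<Longrightarrow> K_ann R 1 = sphere 0 1"
  by (auto simp: K_ann_def dist_norm)

lemma K_ann_subset_annulus:
  assumes "R > 1" "n \<ge> 1"
  shows "K_ann R n \<subseteq> annulus R"
proof -
  have "R powr (-1) < R powr (1 / real n - 1)" "R powr (1 - 1 / real n) < R powr 1"
    using assms by (intro powr_less_mono; simp)+
  moreover have "R powr (-1) = 1 / R" "R powr 1 = R"
    using assms by (simp_all add: powr_minus divide_inverse)
  ultimately show ?thesis unfolding K_ann_def annulus_def by auto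
qed

lemma K_ann_nonempty: "R > 1 \<Longrightarrow> n \<ge> 1 \<Longrightarrow> 1 \<in> K_ann R n"
  by (auto simp: K_ann_def ge_one_powr_ge_zero powr_le_one_le intro: powr_mono[of _ 0 R, simplified])

lemma compact_K_ann: "compact (K_ann R n)"
proof -
  have "K_ann R n = cball 0 (R powr (1 - 1 / real n)) - ball 0 (R powr (1 / real n - 1))"
    by (auto simp: K_ann_def)
  then show ?thesis by (simp add: compact_diff)
qed

text \<open>The supremum defining \<open>sup_norm\<close> is a genuine one: the set is bounded.\<close>

lemma sup_norm_bdd_above:
  assumes "R > 1" "n \<ge> 1" "f \<in> Hol R"
  shows "bdd_above ((\<lambda>z. cmod (f z)) ` K_ann R n)"
proof -
  have "continuous_on (K_ann R n) f"
    using assms(3) K_ann_subset_annulus[OF assms(1,2)]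
    by (auto simp: Hol_def intro: holomorphic_on_imp_continuous_on continuous_on_subset)
  then have "compact ((\<lambda>z. cmod (f z)) ` K_ann R n)"
    by (intro compact_continuous_image compact_K_ann continuous_intros)
  then show ?thesis by (intro bounded_imp_bdd_above compact_imp_bounded)
qed

end

theory Submission
  imports Defs
begin

text \<open>
  The function \<open>T 1\<close> has supremum \<open>1\<close> on the unit circle, which is interior to \<open>K\<^sub>2\<close>, and on
  \<open>K\<^sub>2\<close>; by the maximum modulus principle it is a unimodular constant, so \<open>T 1 = 1\<close> may be assumed.
  Put \<open>h = T z\<close>. Let \<open>r\<close> be the outer radius of \<open>K\<^sub>n\<close>. For \<open>\<bar>d\<bar> = r\<close> the norm of \<open>z + d\<close> on
  \<open>K\<^sub>n\<close> is \<open>2 r\<close>, and hence so is that of \<open>h + d\<close>, which together with \<open>\<bar>h\<bar> \<le> r\<close> forces \<open>h\<close> to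
  take the value \<open>d\<close> on \<open>K\<^sub>n\<close>. Thus \<open>\<bar>h\<bar> = 1\<close> infinitely often on the unit circle, and
  \<open>\<bar>h\<bar> = r\<close> infinitely often on one of the two boundary circles of \<open>K\<^sub>2\<close>. By reflection and the
  identity theorem these equalities hold on the whole circles, so \<open>h / z\<close> or \<open>h * z\<close> is unimodular
  on the boundary of an annulus and has no zeros: it is constant.

  For \<open>\<bar>w\<bar> = 1\<close> the functional \<open>f \<mapsto> T f w\<close> is unital and contractive for the supremum norm of the
  unit circle, hence positive. As it maps \<open>z\<close> to the unimodular number \<open>h w\<close>, it is evaluation at
  \<open>h w\<close>, and so \<open>T f = f \<circ> h\<close> on the unit circle.
\<close>

section \<open>The identity theorem on the annulus\<close>

lemma open_annulus: "open (annulus R)"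
  unfolding annulus_def by (intro open_Collect_conj open_Collect_less continuous_intros)

lemma connected_annulus_Hol: "connected (annulus R)"
  using connected_annulus(1)[of "1 / R" "0 :: complex" R] by (simp add: annulus_def)

lemma nonzero_annulus: "R > 1 \<Longrightarrow> z \<in> annulus R \<Longrightarrow> z \<noteq> 0"
  by (auto simp: annulus_def)

lemma sphere_subset_annulus: "1 / R < r \<Longrightarrow> r < R \<Longrightarrow> sphere 0 r \<subseteq> annulus R"
  by (auto simp: annulus_def)

lemma infinite_sphere_complex:
  assumes "r > 0"
  shows "infinite (sphere (0 :: complex) r)"
proof
  assume "finite (sphere (0 :: complex) r)"
  moreover have "connected (sphere (0 :: complex) r)"
    by (intro connected_sphere) simp
  ultimately have "sphere (0 :: complex) r = {} \<or> (\<exists>a. sphere (0 :: complex) r = {a})"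
    by (simp add: connected_finite_iff_sing)
  moreover have "of_real r \<in> sphere (0 :: complex) r" "- of_real r \<in> sphere (0 :: complex) r"
    using assms by auto
  moreover have "of_real r \<noteq> (- of_real r :: complex)"
    using assms by (simp add: complex_eq_iff)
  ultimately show False by (metis empty_iff singletonD)
qed

text \<open>Infinitely many zeros on a compact circle inside the connected annulus force
  \<open>f - g\<close> to be constant, and its value at one of these zeros is 0.\<close>

lemma annulus_identity:
  assumes hol: "f holomorphic_on annulus R" "g holomorphic_on annulus R"
    and r: "1 / R < r" "r < R"
    and inf: "infinite {z \<in> sphere 0 r. f z = g z}" and z: "z \<in> annulus R"
  shows "f z = g z"
proof -
  have fg: "(\<lambda>z. f z - g z) holomorphic_on annulus R"
    using hol by (intro holomorphic_intros)
  have inf': "infinite {z \<in> sphere 0 r. f z - g z = 0}"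
    using inf by simp
  then have "(\<lambda>z. f z - g z) constant_on annulus R"
    using holomorphic_compact_finite_zeros[OF fg open_annulus connected_annulus_Hol
        compact_sphere sphere_subset_annulus[OF r]] by blast
  moreover obtain w where "w \<in> sphere 0 r" "f w - g w = 0"
    using inf' not_finite_existsD by blast
  ultimately show ?thesis
    using z sphere_subset_annulus[OF r] unfolding constant_on_def
    by (metis in_mono right_minus_eq)
qed

section \<open>Reflection in the unit circle and functions of constant modulus on circles\<close>

lemma inverse_cnj_unit:
  assumes "cmod w = 1"
  shows "1 / cnj w = w"
proof -
  have "w * cnj w = 1" using assms complex_norm_square[of w] by simp
  then show ?thesis by (metis divide_self_if mult_zero_right nonzero_eq_divide_eq zero_neq_one)
qed

text \<open>Since \<open>1 / cnj z\<close> is the reflection of \<open>z\<close> in the unit circle,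
  the left side is holomorphic in \<open>z\<close>, and on the circle it is the squared modulus of
  \<open>h z\<close>. The identity theorem carries the value 1 from infinitely many points of the
  circle to the whole annulus.\<close>

lemma reflection_identity:
  assumes R: "R > 1" and hol: "h holomorphic_on annulus R"
    and inf: "infinite {z \<in> sphere 0 1. cmod (h z) = 1}" and z: "z \<in> annulus R"
  shows "h z * cnj (h (1 / cnj z)) = 1"
proof -
  have "cnj ` annulus R = annulus R"
    unfolding image_cnj_conv_vimage_cnj by (auto simp: annulus_def)
  then have cnj_hol: "cnj \<circ> h \<circ> cnj holomorphic_on annulus R"
    using hol open_annulus by (intro holomorphic_on_compose_cnj_cnj) auto
  have "(\<lambda>z. 1 / z) holomorphic_on annulus R"
    using nonzero_annulus[OF R] by (intro holomorphic_intros) auto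
  moreover note cnj_hol
  moreover have "(\<lambda>z. 1 / z) ` annulus R \<subseteq> annulus R"
    using annulus_divide_iff[OF R, of 1] by auto
  ultimately have "(cnj \<circ> h \<circ> cnj) \<circ> (\<lambda>z. 1 / z) holomorphic_on annulus R"
    by (rule holomorphic_on_compose_gen)
  then have refl: "(\<lambda>z. h z * cnj (h (1 / cnj z))) holomorphic_on annulus R"
    using hol by (intro holomorphic_on_mult) (simp_all add: o_def)
  have "h w * cnj (h (1 / cnj w)) = 1" if "cmod w = 1" "cmod (h w) = 1" for w
    using that complex_norm_square[of "h w"] by (simp add: inverse_cnj_unit)
  then have "{z \<in> sphere 0 1. cmod (h z) = 1} \<subseteq> {z \<in> sphere 0 1. h z * cnj (h (1 / cnj z)) = 1}"
    by auto
  with inf have "infinite {z \<in> sphere 0 1. h z * cnj (h (1 / cnj z)) = 1}"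
    using infinite_super by blast
  then show ?thesis
    using annulus_identity[OF refl holomorphic_on_const, of 1 1 z] R z by auto
qed

text \<open>The reflection fixes the points of the unit circle, so there the reflection identity
  says that the squared modulus of \<open>h w\<close> is 1.\<close>

lemma unimodular_on_circle:
  assumes R: "R > 1" and hol: "h holomorphic_on annulus R"
    and inf: "infinite {z \<in> sphere 0 1. cmod (h z) = 1}" and w: "cmod w = 1"
  shows "cmod (h w) = 1"
proof -
  have "w \<in> annulus R" using R w by (simp add: annulus_def)
  then have "h w * cnj (h w) = 1"
    using reflection_identity[OF R hol inf, of w] w by (simp add: inverse_cnj_unit)
  then have "(cmod (h w))\<^sup>2 = 1" by (metis complex_norm_square of_real_eq_1_iff)
  then show ?thesis by (simp add: power2_eq_1_iff) (metis norm_ge_zero not_one_le_zero neg_0_le_iff_le)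
qed

lemma unimodular_on_dilated_circle:
  assumes R: "R > 1" and r: "1 / R < r" "r < R" and hol: "h holomorphic_on annulus R" and s: "s > 0"
    and inf: "infinite {z \<in> sphere 0 r. cmod (h z) = s}" and w: "cmod w = r"
  shows "cmod (h w) = s"
proof -
  have r0: "r > 0" using R r by (meson order_less_trans zero_less_divide_1_iff zero_less_one)
  \<comment> \<open>\<open>annulus \<rho>\<close> is the largest symmetric annulus whose dilation by
    \<open>r\<close> stays in \<open>annulus R\<close>. On it the rescaled function \<open>g\<close>
    below falls under the case of the unit circle.\<close>
  define \<rho> where "\<rho> = min (R / r) (R * r)"
  have \<rho>: "\<rho> > 1" using R r r0 by (auto simp: \<rho>_def field_simps)
  have sub: "of_real r * z \<in> annulus R" if "z \<in> annulus \<rho>" for z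
  proof -
    have "1 < cmod z * \<rho>" "cmod z < \<rho>" using that \<rho> by (auto simp: annulus_def field_simps)
    moreover have "\<rho> \<le> R * r" "\<rho> \<le> R / r" by (auto simp: \<rho>_def)
    moreover have "cmod z * \<rho> \<le> cmod z * (R * r)" using calculation by (intro mult_left_mono) auto
    ultimately have "1 < cmod z * (R * r)" "cmod z < R / r" by linarith+
    then show ?thesis using r0 R by (auto simp: annulus_def norm_mult field_simps)
  qed
  define g where "g z = h (of_real r * z) / of_real s" for z
  have "h \<circ> (\<lambda>z. of_real r * z) holomorphic_on annulus \<rho>"
    using sub hol by (intro holomorphic_on_compose_gen[where t = "annulus R"] holomorphic_intros) auto
  then have g: "g holomorphic_on annulus \<rho>"
    using s by (auto simp: g_def[abs_def] o_def intro!: holomorphic_intros)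
  have "{z \<in> sphere 0 r. cmod (h z) = s} \<subseteq> (\<lambda>z. of_real r * z) ` {z \<in> sphere 0 1. cmod (g z) = 1}"
  proof
    fix z assume "z \<in> {z \<in> sphere 0 r. cmod (h z) = s}"
    then show "z \<in> (\<lambda>z. of_real r * z) ` {z \<in> sphere 0 1. cmod (g z) = 1}"
      using r0 s by (intro image_eqI[of _ _ "z / of_real r"]) (auto simp: g_def norm_divide)
  qed
  with inf have "infinite {z \<in> sphere 0 1. cmod (g z) = 1}"
    using finite_imageI infinite_super by blast
  then have "cmod (g (w / of_real r)) = 1"
    using w r0 by (intro unimodular_on_circle[OF \<rho> g]) (auto simp: norm_divide)
  then show ?thesis using r0 s by (simp add: g_def norm_divide field_simps)
qed

text \<open>The maximum modulus principle between the two circles, applied to \<open>k\<close> and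
  to \<open>1 / k\<close>, gives modulus 1 throughout; a maximum of the modulus at an interior point
  then makes \<open>k\<close> constant.\<close>

lemma annulus_unimodular_constant:
  assumes R: "R > 1" and hol: "k holomorphic_on annulus R" and nz: "\<And>z. z \<in> annulus R \<Longrightarrow> k z \<noteq> 0"
    and ab: "1 / R < a" "a < b" "b < R"
    and unim: "\<And>z. cmod z = a \<or> cmod z = b \<Longrightarrow> cmod (k z) = 1"
  shows "\<exists>\<beta>\<in>sphere 0 1. \<forall>z\<in>annulus R. k z = \<beta>"
proof -
  define S where "S = {z :: complex. a < cmod z \<and> cmod z < b}"
  have "open S"
    unfolding S_def by (intro open_Collect_conj open_Collect_less continuous_intros)
  have "closed {z :: complex. a \<le> cmod z \<and> cmod z \<le> b}"
    by (intro closed_Collect_conj closed_Collect_le continuous_intros)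
  then have cl: "closure S \<subseteq> {z. a \<le> cmod z \<and> cmod z \<le> b}"
    by (intro closure_minimal) (auto simp: S_def)
  then have cl': "closure S \<subseteq> annulus R" using ab by (auto simp: annulus_def)
  then have "S \<subseteq> annulus R" using closure_subset by blast
  have fr: "cmod z = a \<or> cmod z = b" if "z \<in> frontier S" for z
    using that cl \<open>open S\<close> by (auto simp: frontier_def interior_open S_def)
  have "bounded S" by (rule bounded_subset[of "ball 0 b"]) (auto simp: S_def)
  have le: "cmod (g z) \<le> 1" 
    if "g holomorphic_on annulus R" "\<And>z. cmod z = a \<or> cmod z = b \<Longrightarrow> cmod (g z) \<le> 1" "z \<in> S" for g z
  proof (rule maximum_modulus_frontier[OF _ _ \<open>bounded S\<close> _ \<open>z \<in> S\<close>])
    show "g holomorphic_on interior S"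
      using that(1) \<open>S \<subseteq> annulus R\<close> \<open>open S\<close> by (simp add: interior_open holomorphic_on_subset)
    show "continuous_on (closure S) g"
      using that(1) cl' holomorphic_on_imp_continuous_on continuous_on_subset by blast
  qed (use that fr in auto)
  have one: "cmod (k z) = 1" if "z \<in> S" for z
  proof -
    have "cmod (1 / k z) \<le> 1"
    proof (rule le[OF _ _ that])
      show "(\<lambda>z. 1 / k z) holomorphic_on annulus R"
        using hol nz by (intro holomorphic_intros) auto
    qed (simp add: unim norm_divide)
    moreover have "cmod (k z) > 0" using nz that \<open>S \<subseteq> annulus R\<close> by auto
    ultimately have "cmod (k z) \<ge> 1" by (simp add: norm_divide)
    moreover have "cmod (k z) \<le> 1" by (rule le[OF hol _ that]) (simp add: unim)
    ultimately show ?thesis by simp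
  qed
  define \<xi> :: complex where "\<xi> = of_real ((a + b) / 2)"
  have "a > 0" using R ab by (meson order_less_trans zero_less_divide_1_iff zero_less_one)
  then have "\<xi> \<in> S" using ab unfolding S_def \<xi>_def by (simp only: norm_of_real mem_Collect_eq) auto
  have "k constant_on annulus R"
    by (rule maximum_modulus_principle[OF hol open_annulus connected_annulus_Hol \<open>open S\<close>
          \<open>S \<subseteq> annulus R\<close> \<open>\<xi> \<in> S\<close>]) (use one \<open>\<xi> \<in> S\<close> in auto)
  then obtain \<beta> where "\<forall>z\<in>annulus R. k z = \<beta>" by (auto simp: constant_on_def)
  moreover have "cmod \<beta> = 1" using calculation one[OF \<open>\<xi> \<in> S\<close>] \<open>\<xi> \<in> S\<close> \<open>S \<subseteq> annulus R\<close> by auto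
  ultimately show ?thesis by auto
qed

section \<open>Functions cut off outside the annulus as elements of \<open>Hol R\<close>\<close>

definition ann_ext :: "real \<Rightarrow> (complex \<Rightarrow> complex) \<Rightarrow> complex \<Rightarrow> complex" where
  "ann_ext R f = (\<lambda>z. if z \<in> annulus R then f z else 0)"

lemma ann_ext_in_Hol:
  assumes "f holomorphic_on annulus R"
  shows "ann_ext R f \<in> Hol R"
proof -
  have "ann_ext R f holomorphic_on annulus R"
    using assms by (subst holomorphic_cong[OF refl, of _ _ f]) (auto simp: ann_ext_def)
  then show ?thesis by (auto simp: Hol_def ann_ext_def)
qed

lemma Hol_add: "f \<in> Hol R \<Longrightarrow> g \<in> Hol R \<Longrightarrow> (\<lambda>z. f z + g z) \<in> Hol R"
  by (auto simp: Hol_def intro!: holomorphic_intros)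

lemma Hol_scale: "f \<in> Hol R \<Longrightarrow> (\<lambda>z. c * f z) \<in> Hol R"
  by (auto simp: Hol_def intro!: holomorphic_intros)

text \<open>On the annulus this is the identity theorem for the circle of radius 1; off the annulus
  both functions are 0.\<close>

lemma Hol_eq_of_eq_unit_circle:
  assumes R: "R > 1" and f: "f \<in> Hol R" and g: "g \<in> Hol R" and eq: "\<And>w. cmod w = 1 \<Longrightarrow> f w = g w"
  shows "f = g"
proof
  fix z
  have "{w \<in> sphere 0 1. f w = g w} = sphere 0 1" using eq by auto
  then have "infinite {w \<in> sphere 0 1. f w = g w}" using infinite_sphere_complex[of 1] by simp
  then show "f z = g z"
    using annulus_identity[of f R g 1 z] f g R by (cases "z \<in> annulus R") (auto simp: Hol_def)
qed

section \<open>Positivity of unital contractive functionals\<close>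

locale unital_contractive_functional =
  fixes R :: real and K :: "complex set" and \<phi> :: "(complex \<Rightarrow> complex) \<Rightarrow> complex"
  assumes K: "compact K" "K \<subseteq> annulus R"
    and add: "\<And>f g. f \<in> Hol R \<Longrightarrow> g \<in> Hol R \<Longrightarrow> \<phi> (\<lambda>z. f z + g z) = \<phi> f + \<phi> g"
    and scale: "\<And>c f. f \<in> Hol R \<Longrightarrow> \<phi> (\<lambda>z. c * f z) = c * \<phi> f"
    and unital: "\<phi> (ann_ext R (\<lambda>_. 1)) = 1"
    and contractive: "\<And>f B. f \<in> Hol R \<Longrightarrow> (\<And>z. z \<in> K \<Longrightarrow> cmod (f z) \<le> B) \<Longrightarrow> cmod (\<phi> f) \<le> B"
begin

lemma bounded_on:
  assumes "f \<in> Hol R"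
  obtains B where "B \<ge> 0" "\<And>z. z \<in> K \<Longrightarrow> cmod (f z) \<le> B"
proof -
  have "continuous_on K f"
    using assms K(2) by (auto simp: Hol_def intro: holomorphic_on_imp_continuous_on continuous_on_subset)
  then have "bounded (f ` K)" using K(1) compact_continuous_image compact_imp_bounded by blast
  then obtain B where "B > 0" "\<forall>x\<in>f ` K. norm x \<le> B" using bounded_pos by blast
  then show thesis by (intro that[of B]) auto
qed

text \<open>Compare \<open>\<phi> (f + s)\<close> with the supremum of \<open>f + s\<close> for a large real constant \<open>s\<close>.\<close>

lemma Re_le:
  assumes f: "f \<in> Hol R" and M: "\<And>z. z \<in> K \<Longrightarrow> Re (f z) \<le> M"
  shows "Re (\<phi> f) \<le> M"
proof (rule ccontr)
  assume "\<not> Re (\<phi> f) \<le> M"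
  then have d: "Re (\<phi> f) - M > 0" by simp
  obtain B where B: "B \<ge> 0" "\<And>z. z \<in> K \<Longrightarrow> cmod (f z) \<le> B" using bounded_on[OF f] by blast
  \<comment> \<open>The first two summands make \<open>s * (Re (\<phi> f) - M)\<close> exceed the
    square of \<open>B\<close>, whereas squaring the contractivity estimate for \<open>f + s\<close>
    bounds twice this product by that square.\<close>
  define s where "s = B\<^sup>2 / (Re (\<phi> f) - M) + 1 + B + \<bar>M\<bar>"
  have s: "s \<ge> B\<^sup>2 / (Re (\<phi> f) - M) + 1" "s \<ge> 0" "B\<^sup>2 / (Re (\<phi> f) - M) \<ge> 0"
    using B(1) d by (auto simp: s_def)
  let ?one = "ann_ext R (\<lambda>_. 1)"
  let ?F = "\<lambda>z. f z + of_real s * ?one z"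
  have one: "?one \<in> Hol R" by (simp add: ann_ext_in_Hol)
  have eq: "(cmod (u + of_real s))\<^sup>2 = (cmod u)\<^sup>2 + 2 * s * Re u + s\<^sup>2" for u
    by (simp add: cmod_power2 power2_sum)
  have "cmod (?F z) \<le> sqrt (B\<^sup>2 + 2 * s * M + s\<^sup>2)" if "z \<in> K" for z
  proof (rule real_le_rsqrt)
    have F: "?F z = f z + of_real s" using that K by (auto simp: ann_ext_def)
    have "(cmod (f z))\<^sup>2 \<le> B\<^sup>2" using B that by (intro power_mono) auto
    moreover have "2 * s * Re (f z) \<le> 2 * s * M" using M[OF that] s by (intro mult_left_mono) auto
    ultimately show "(cmod (?F z))\<^sup>2 \<le> B\<^sup>2 + 2 * s * M + s\<^sup>2"
      unfolding F eq by linarith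
  qed
  moreover have "?F \<in> Hol R" using f one by (intro Hol_add Hol_scale)
  ultimately have "cmod (\<phi> ?F) \<le> sqrt (B\<^sup>2 + 2 * s * M + s\<^sup>2)"
    by (rule contractive[rotated])
  moreover have "\<phi> ?F = \<phi> f + of_real s"
    using f one by (simp add: add[OF f Hol_scale[OF one]] scale unital)
  ultimately have le: "cmod (\<phi> f + of_real s) \<le> sqrt (B\<^sup>2 + 2 * s * M + s\<^sup>2)" by simp
  have "B\<^sup>2 + 2 * s * M + s\<^sup>2 \<ge> 0"
    using order_trans[OF norm_ge_zero le] real_sqrt_ge_0_iff by blast
  with le have "(cmod (\<phi> f + of_real s))\<^sup>2 \<le> B\<^sup>2 + 2 * s * M + s\<^sup>2"
    by (metis norm_ge_zero power_mono real_sqrt_pow2)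
  then have "2 * s * Re (\<phi> f) + (cmod (\<phi> f))\<^sup>2 \<le> B\<^sup>2 + 2 * s * M" by (simp add: eq)
  then have 1: "2 * (s * (Re (\<phi> f) - M)) \<le> B\<^sup>2"
    using zero_le_power2[of "cmod (\<phi> f)"] unfolding right_diff_distrib by linarith
  have "B\<^sup>2 < s * (Re (\<phi> f) - M)" using s(1) d by (simp add: field_simps)
  with 1 zero_le_power2[of B] show False by linarith
qed

end

text \<open>Extremality puts the image of the coordinate function on the circle itself, which makes
  it the candidate for the evaluation point.\<close>

locale circle_functional = unital_contractive_functional R "sphere 0 1" \<phi> for R \<phi> +
  assumes extremal: "cmod (\<phi> (ann_ext R (\<lambda>z. z))) = 1"
begin

text \<open>Near \<open>b\<close> the function \<open>f - f b\<close> is small and away from \<open>b\<close> it is dominated by a multiple of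
  \<open>\<bar>z - b\<bar>\<^sup>2\<close>, which on the unit circle is the real part of \<open>2 - 2 * cnj b * z\<close>, a function
  annihilated by \<open>\<phi>\<close>.\<close>

lemma eq_eval:
  assumes f: "f \<in> Hol R"
  shows "\<phi> f = f (\<phi> (ann_ext R (\<lambda>z. z)))"
proof -
  define b where "b = \<phi> (ann_ext R (\<lambda>z. z))"
  let ?one = "ann_ext R (\<lambda>_. 1)" and ?id = "ann_ext R (\<lambda>z. z)"
  have b: "cmod b = 1" using extremal by (simp add: b_def)
  have one: "?one \<in> Hol R" and id: "?id \<in> Hol R" by (simp_all add: ann_ext_in_Hol)
  have b_sph: "b \<in> sphere 0 1" using b by simp
  obtain B where B: "B \<ge> 0" "\<And>z. z \<in> sphere 0 1 \<Longrightarrow> cmod (f z) \<le> B" using bounded_on[OF f] by blast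
  have cont: "continuous_on (sphere 0 1) f"
    using f K(2) by (auto simp: Hol_def intro: holomorphic_on_imp_continuous_on continuous_on_subset)
  \<comment> \<open>\<open>Re_le\<close> controls real parts only; the free unimodular factor
    \<open>c\<close> recovers the modulus of \<open>\<phi> f - f b\<close>.\<close>
  have main: "Re (c * (\<phi> f - f b)) \<le> e" if c: "cmod c = 1" and e: "e > 0" for c e
  proof -
    obtain d where d: "d > 0" "\<And>z. z \<in> sphere 0 1 \<Longrightarrow> dist z b < d \<Longrightarrow> dist (f z) (f b) < e"
      using cont b_sph e unfolding continuous_on_iff by metis
    \<comment> \<open>At distance at least \<open>d\<close> from \<open>b\<close>, \<open>C\<close>
      times the squared distance is at least \<open>2 * B\<close>, which bounds
      \<open>cmod (f z - f b)\<close>.\<close>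
    define C where "C = 2 * B / d\<^sup>2"
    have C: "C \<ge> 0" using B(1) by (simp add: C_def)
    \<comment> \<open>On the annulus this is
      \<open>c * (f z - f b) - 2 * C * (1 - cnj b * z)\<close>, arranged as a combination of
      elements of \<open>Hol R\<close>. The second term contributes nothing to
      \<open>\<phi> F\<close>, because \<open>cnj b * b = 1\<close>.\<close>
    define F where "F = (\<lambda>z. c * f z + ((- c * f b - of_real (2 * C)) * ?one z + (of_real (2 * C) * cnj b) * ?id z))"
    have 1: "Re (\<phi> F) \<le> e"
    proof (rule Re_le)
      show "F \<in> Hol R" unfolding F_def using f one id by (intro Hol_add Hol_scale)
      fix z :: complex assume z: "z \<in> sphere 0 1"
      then have zA: "z \<in> annulus R" using K by blast
      have "(cmod (z - b))\<^sup>2 = (cmod z)\<^sup>2 + (cmod b)\<^sup>2 - 2 * Re (cnj b * z)"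
        unfolding cmod_power2 by (simp add: power2_eq_square algebra_simps)
      then have sq: "(cmod (z - b))\<^sup>2 = 2 - 2 * Re (cnj b * z)" using z b by simp
      have F: "F z = c * (f z - f b) - of_real (2 * C) * (1 - cnj b * z)"
        using zA by (simp add: F_def ann_ext_def algebra_simps)
      have "Re (F z) = Re (c * (f z - f b)) - 2 * C * (1 - Re (cnj b * z))"
        unfolding F by simp
      also have "\<dots> = Re (c * (f z - f b)) - C * (cmod (z - b))\<^sup>2"
        by (simp only: sq) (simp add: algebra_simps)
      also have "Re (c * (f z - f b)) \<le> cmod (f z - f b)"
        using complex_Re_le_cmod[of "c * (f z - f b)"] c by (simp add: norm_mult)
      also have "cmod (f z - f b) \<le> e + C * (cmod (z - b))\<^sup>2"
      proof (cases "dist z b < d")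
        case True
        then have "cmod (f z - f b) < e" using d(2)[OF z] by (simp add: dist_norm)
        moreover have "C * (cmod (z - b))\<^sup>2 \<ge> 0" using C by simp
        ultimately show ?thesis by linarith
      next
        case False
        then have "d\<^sup>2 \<le> (cmod (z - b))\<^sup>2" using d(1) by (intro power_mono) (auto simp: dist_norm)
        then have "C * d\<^sup>2 \<le> C * (cmod (z - b))\<^sup>2" using C by (intro mult_left_mono)
        moreover have "C * d\<^sup>2 = 2 * B" using d(1) by (simp add: C_def)
        moreover have "cmod (f z - f b) \<le> 2 * B"
          using norm_triangle_ineq4[of "f z" "f b"] B(2)[OF z] B(2)[OF b_sph] by linarith
        ultimately show ?thesis using e by linarith
      qed
      finally show "Re (F z) \<le> e" by simp
    qed
    have "\<phi> F = c * \<phi> f + ((- c * f b - of_real (2 * C)) + (of_real (2 * C) * cnj b) * b)"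
      unfolding F_def using f one id
      by (simp add: add[OF Hol_scale[OF f] Hol_add[OF Hol_scale Hol_scale]] add Hol_scale Hol_add scale unital flip: b_def)
    moreover have "cnj b * b = 1" using b complex_norm_square[of b] by (simp add: mult.commute)
    ultimately have "\<phi> F = c * (\<phi> f - f b)" by (simp only: mult.assoc) (simp add: algebra_simps)
    with 1 show ?thesis by simp
  qed
  have "\<phi> f - f b = 0"
  proof (rule ccontr)
    define u where "u = \<phi> f - f b"
    assume "\<phi> f - f b \<noteq> 0"
    then have u: "u \<noteq> 0" by (simp add: u_def)
    \<comment> \<open>With this rotation the real part becomes \<open>cmod u\<close>, so taking
      \<open>e\<close> to be \<open>cmod u / 2\<close> is contradictory.\<close>
    have "cmod (cnj (sgn u)) = 1" using u by (simp add: norm_sgn)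
    then have "Re (cnj (sgn u) * u) \<le> cmod u / 2"
      unfolding u_def using u by (intro main) (auto simp: u_def)
    moreover have "cnj (sgn u) * u = of_real (cmod u)"
      using u complex_norm_square[of u] by (simp add: sgn_eq field_simps power2_eq_square)
    ultimately show False using u by simp
  qed
  then show ?thesis by (simp add: b_def)
qed

end

section \<open>The supremum norms and the maximum modulus principle on
  \<open>K_ann R 2\<close>\<close>

lemma K_ann_iff:
  assumes "R > 1"
  shows "z \<in> K_ann R n \<longleftrightarrow> 1 / R powr (1 - 1 / real n) \<le> cmod z \<and> cmod z \<le> R powr (1 - 1 / real n)"
proof -
  have "R powr (1 / real n - 1) = 1 / R powr (1 - 1 / real n)"
    using powr_minus_divide[of R "1 - 1 / real n"] by simp
  then show ?thesis by (simp add: K_ann_def)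
qed

lemma sup_norm_upper:
  assumes "R > 1" "n \<ge> 1" "f \<in> Hol R" "z \<in> K_ann R n"
  shows "cmod (f z) \<le> sup_norm R n f"
  unfolding sup_norm_def using assms by (intro cSUP_upper sup_norm_bdd_above)

lemma sup_norm_least:
  assumes "R > 1" "n \<ge> 1" "\<And>z. z \<in> K_ann R n \<Longrightarrow> cmod (f z) \<le> B"
  shows "sup_norm R n f \<le> B"
  unfolding sup_norm_def using assms K_ann_nonempty by (intro cSUP_least) auto

lemma sup_norm_attained:
  assumes "R > 1" "n \<ge> 1" "f \<in> Hol R"
  obtains w where "w \<in> K_ann R n" "cmod (f w) = sup_norm R n f"
proof -
  have "continuous_on (K_ann R n) f"
    using assms(3) K_ann_subset_annulus[OF assms(1,2)]
    by (auto simp: Hol_def intro: holomorphic_on_imp_continuous_on continuous_on_subset)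
  then have "continuous_on (K_ann R n) (\<lambda>z. cmod (f z))" by (intro continuous_intros)
  moreover have "K_ann R n \<noteq> {}" using K_ann_nonempty assms by blast
  ultimately obtain w where w: "w \<in> K_ann R n" "\<forall>z\<in>K_ann R n. cmod (f z) \<le> cmod (f w)"
    using continuous_attains_sup[OF compact_K_ann] by blast
  then have "sup_norm R n f \<le> cmod (f w)" using assms by (intro sup_norm_least) auto
  with w sup_norm_upper[OF assms w(1)] show thesis by (intro that[of w]) auto
qed

text \<open>\<open>K_ann R 1\<close> is a circle, so \<open>K_ann R 2\<close> is the first of these
  sets with interior points. The strict inequalities place \<open>\<xi>\<close> in that
  interior.\<close>

lemma maximum_modulus_K_ann_2:
  assumes R: "R > 1" and hol: "f holomorphic_on annulus R"
    and \<xi>: "1 / R powr (1 / 2) < cmod \<xi>" "cmod \<xi> < R powr (1 / 2)"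
    and le: "\<And>z. z \<in> K_ann R 2 \<Longrightarrow> cmod (f z) \<le> cmod (f \<xi>)"
  shows "\<exists>c. \<forall>z\<in>annulus R. f z = c"
proof -
  define U where "U = {z :: complex. 1 / R powr (1 / 2) < cmod z \<and> cmod z < R powr (1 / 2)}"
  have "open U" unfolding U_def by (intro open_Collect_conj open_Collect_less continuous_intros)
  have "U \<subseteq> K_ann R 2" by (auto simp: U_def K_ann_iff[OF R])
  moreover have "K_ann R 2 \<subseteq> annulus R" by (rule K_ann_subset_annulus[OF R]) simp
  ultimately have "U \<subseteq> annulus R" by blast
  have "\<xi> \<in> U" using \<xi> by (simp add: U_def)
  have "f constant_on annulus R"
    using maximum_modulus_principle[OF hol open_annulus connected_annulus_Hol
        \<open>open U\<close> \<open>U \<subseteq> annulus R\<close> \<open>\<xi> \<in> U\<close>] le \<open>U \<subseteq> K_ann R 2\<close> by blast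
  then show ?thesis by (simp add: constant_on_def)
qed

section \<open>Unital isometries and the image of the coordinate function\<close>

locale unital_isometry =
  fixes R :: real and T :: "(complex \<Rightarrow> complex) \<Rightarrow> (complex \<Rightarrow> complex)"
  assumes R: "R > 1"
    and maps: "\<And>f. f \<in> Hol R \<Longrightarrow> T f \<in> Hol R"
    and add: "\<And>f g. f \<in> Hol R \<Longrightarrow> g \<in> Hol R \<Longrightarrow> T (\<lambda>z. f z + g z) = (\<lambda>z. T f z + T g z)"
    and scale: "\<And>c f. f \<in> Hol R \<Longrightarrow> T (\<lambda>z. c * f z) = (\<lambda>z. c * T f z)"
    and isometry: "\<And>f n. f \<in> Hol R \<Longrightarrow> n \<ge> 1 \<Longrightarrow> sup_norm R n (T f) = sup_norm R n f"
    and unital: "T (ann_ext R (\<lambda>_. 1)) = ann_ext R (\<lambda>_. 1)"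
begin

lemma contractive:
  assumes "f \<in> Hol R" "n \<ge> 1" "\<And>z. z \<in> K_ann R n \<Longrightarrow> cmod (f z) \<le> B" "w \<in> K_ann R n"
  shows "cmod (T f w) \<le> B"
  using sup_norm_upper[OF R assms(2) maps[OF assms(1)] assms(4)] isometry[OF assms(1,2)]
    sup_norm_least[of R n f B, OF R assms(2,3)] by linarith

text \<open>If the operator is composition with some map, that map is the image of the coordinate
  function.\<close>

definition h :: "complex \<Rightarrow> complex" where
  "h = T (ann_ext R (\<lambda>z. z))"

lemma holomorphic_h: "h holomorphic_on annulus R"
  using maps[OF ann_ext_in_Hol, of "\<lambda>z. z"] by (simp add: h_def Hol_def)

lemma norm_h_le:
  assumes "n \<ge> 1" "w \<in> K_ann R n"
  shows "cmod (h w) \<le> R powr (1 - 1 / real n)"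
  unfolding h_def
proof (rule contractive[OF _ assms(1) _ assms(2)])
  fix z assume z: "z \<in> K_ann R n"
  then have "z \<in> annulus R" using K_ann_subset_annulus[OF R assms(1)] by blast
  with z show "cmod (ann_ext R (\<lambda>z. z) z) \<le> R powr (1 - 1 / real n)"
    by (simp add: ann_ext_def K_ann_iff[OF R])
qed (simp add: ann_ext_in_Hol)

text \<open>The function \<open>z + d\<close> has modulus \<open>2 * \<rho>\<close> at
  \<open>z = d\<close>, and the norm of its image \<open>h + d\<close> is attained at some
  \<open>w\<close>. Both \<open>h w\<close> and \<open>d\<close> have modulus at most
  \<open>\<rho>\<close>, so equality holds in the triangle inequality.\<close>

lemma h_onto:
  assumes n: "n \<ge> 1" and d: "cmod d = R powr (1 - 1 / real n)"
  shows "\<exists>w\<in>K_ann R n. h w = d"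
proof -
  let ?id = "ann_ext R (\<lambda>z. z)" and ?one = "ann_ext R (\<lambda>_. 1)"
  let ?F = "\<lambda>z. ?id z + d * ?one z"
  define \<rho> where "\<rho> = R powr (1 - 1 / real n)"
  have \<rho>: "\<rho> \<ge> 1" unfolding \<rho>_def using R n by (intro ge_one_powr_ge_zero) auto
  have id: "?id \<in> Hol R" and one: "?one \<in> Hol R" by (simp_all add: ann_ext_in_Hol)
  have F: "?F \<in> Hol R" using id one by (intro Hol_add Hol_scale)
  have "1 / \<rho> \<le> \<rho>" using \<rho> by (meson divide_le_eq_1 le_numeral_extra(4) order_trans zero_less_one less_le_trans)
  then have dK: "d \<in> K_ann R n" using d by (simp add: K_ann_iff[OF R] \<rho>_def)
  then have dA: "d \<in> annulus R" using K_ann_subset_annulus[OF R n] by blast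
  obtain w where w: "w \<in> K_ann R n" "cmod (T ?F w) = sup_norm R n (T ?F)"
    using sup_norm_attained[OF R n maps[OF F]] by blast
  have wA: "w \<in> annulus R" using w(1) K_ann_subset_annulus[OF R n] by blast
  have "cmod (?F d) \<le> sup_norm R n ?F" by (rule sup_norm_upper[OF R n F dK])
  moreover have "cmod (?F d) = 2 * \<rho>"
    using dA d norm_mult[of 2 d] by (simp add: ann_ext_def \<rho>_def)
  moreover have "T ?F w = h w + d"
    using wA by (simp add: add[OF id Hol_scale[OF one]] scale[OF one] unital h_def)
      (simp add: ann_ext_def)
  ultimately have "2 * \<rho> \<le> cmod (h w + d)" using w(2) isometry[OF F n] by simp
  then have 1: "(2 * \<rho>)\<^sup>2 \<le> (cmod (h w + d))\<^sup>2" using \<rho> by (intro power_mono) auto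
  have "cmod (h w) \<le> \<rho>" using norm_h_le[OF n w(1)] by (simp add: \<rho>_def)
  then have 2: "(cmod (h w))\<^sup>2 \<le> \<rho>\<^sup>2" by (intro power_mono) auto
  \<comment> \<open>The parallelogram law: the right side is at most
    \<open>2 * \<rho>^2 + 2 * \<rho>^2 - (2 * \<rho>)^2\<close>, which is 0.\<close>
  have 3: "(cmod (h w - d))\<^sup>2 = 2 * (cmod (h w))\<^sup>2 + 2 * (cmod d)\<^sup>2 - (cmod (h w + d))\<^sup>2"
    unfolding cmod_power2 by (simp add: power2_eq_square algebra_simps)
  have "(cmod (h w - d))\<^sup>2 \<le> 0"
    using 1 2 d[folded \<rho>_def] unfolding 3 by (simp add: power_mult_distrib)
  then have "h w = d" by simp
  with w(1) show ?thesis by blast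
qed

lemma infinite_extremal_1: "infinite {w \<in> sphere 0 1. cmod (h w) = 1}"
proof -
  have "sphere 0 1 \<subseteq> h ` {w \<in> sphere 0 1. cmod (h w) = 1}"
  proof
    fix d :: complex assume d: "d \<in> sphere 0 1"
    then obtain w where "w \<in> K_ann R 1" "h w = d" using R h_onto[of 1 d] by auto
    with d R show "d \<in> h ` {w \<in> sphere 0 1. cmod (h w) = 1}" unfolding K_ann_1[OF R] by auto
  qed
  then have "infinite (h ` {w \<in> sphere 0 1. cmod (h w) = 1})"
    using infinite_super infinite_sphere_complex[OF zero_less_one] by blast
  then show ?thesis by blast
qed

lemma norm_h_unit_circle: "cmod w = 1 \<Longrightarrow> cmod (h w) = 1"
  by (rule unimodular_on_circle[OF R holomorphic_h infinite_extremal_1])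

text \<open>A factor of a product equal to 1 cannot vanish.\<close>

lemma h_nonzero: "z \<in> annulus R \<Longrightarrow> h z \<noteq> 0"
  using reflection_identity[OF R holomorphic_h infinite_extremal_1] by fastforce

text \<open>Every number of modulus \<open>r\<close> is a value of \<open>h\<close> on
  \<open>K_ann R 2\<close>. Such values occur only on the two boundary circles: at an interior point
  the maximum modulus principle would make \<open>h\<close> constant, yet it takes the values
  \<open>r\<close> and \<open>- r\<close>. One of the circles must carry infinitely many of
  them.\<close>

lemma infinite_extremal_2:
  fixes r :: real
  defines "r \<equiv> R powr (1 / 2)"
  shows "infinite {w \<in> sphere 0 r. cmod (h w) = r} \<or> infinite {w \<in> sphere 0 (1 / r). cmod (h w) = r}"
proof -
  have r: "r > 1" using R unfolding r_def by (intro gr_one_powr) auto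
  have K: "z \<in> K_ann R 2 \<longleftrightarrow> 1 / r \<le> cmod z \<and> cmod z \<le> r" for z
    by (simp add: K_ann_iff[OF R] r_def)
  have "K_ann R 2 \<subseteq> annulus R" by (rule K_ann_subset_annulus[OF R]) simp
  have onto: "\<exists>w \<in> K_ann R 2. h w = d" if "cmod d = r" for d
    using that h_onto[of 2 d] by (simp add: r_def)
  have bdry: "cmod w = r \<or> cmod w = 1 / r" if w: "w \<in> K_ann R 2" "cmod (h w) = r" for w
  proof (rule ccontr)
    assume "\<not> (cmod w = r \<or> cmod w = 1 / r)"
    then have "1 / r < cmod w" "cmod w < r" using w(1) K[of w] by auto
    moreover have "cmod (h z) \<le> cmod (h w)" if "z \<in> K_ann R 2" for z
      using norm_h_le[of 2 z] w(2) that by (simp add: r_def)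
    ultimately obtain c where c: "\<And>z. z \<in> K_ann R 2 \<Longrightarrow> h z = c"
      using maximum_modulus_K_ann_2[OF R holomorphic_h, of w] \<open>K_ann R 2 \<subseteq> annulus R\<close>
      unfolding r_def by blast
    from onto[of "of_real r"] onto[of "- of_real r"] r c
    have "c = of_real r" "c = - of_real r" by auto
    then show False using r by (simp add: complex_eq_iff)
  qed
  have "sphere 0 r \<subseteq> h ` ({w \<in> sphere 0 r. cmod (h w) = r} \<union> {w \<in> sphere 0 (1 / r). cmod (h w) = r})"
  proof
    fix d :: complex assume "d \<in> sphere 0 r"
    then have d: "cmod d = r" by simp
    with onto obtain w where "w \<in> K_ann R 2" "h w = d" by blast
    with bdry[of w] d
    show "d \<in> h ` ({w \<in> sphere 0 r. cmod (h w) = r} \<union> {w \<in> sphere 0 (1 / r). cmod (h w) = r})"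
      by auto
  qed
  moreover have "infinite (sphere (0 :: complex) r)" using r by (intro infinite_sphere_complex) auto
  ultimately have "infinite (h ` ({w \<in> sphere 0 r. cmod (h w) = r} \<union> {w \<in> sphere 0 (1 / r). cmod (h w) = r}))"
    using infinite_super by blast
  then show ?thesis using finite_UnI finite_imageI by blast
qed

text \<open>The modulus of \<open>h\<close> is 1 on the unit circle and \<open>r\<close> on the
  outer or the inner boundary circle of \<open>K_ann R 2\<close>. Accordingly \<open>h z / z\<close>
  or \<open>h z * z\<close> is unimodular on two circles; having no zeros, it is constant.\<close>

lemma h_cases:
  obtains \<beta> where "cmod \<beta> = 1" "\<And>z. z \<in> annulus R \<Longrightarrow> h z = \<beta> * z"
    | \<beta> where "cmod \<beta> = 1" "\<And>z. z \<in> annulus R \<Longrightarrow> h z = \<beta> / z"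
proof -
  define r where "r = R powr (1 / 2)"
  have r: "1 < r" "r < R" using R powr_less_mono[of "1 / 2" 1 R]
    by (auto simp: r_def intro: gr_one_powr)
  then have r': "1 / R < 1 / r" "1 / r < 1" by (auto simp: field_simps)
  have nz: "z \<noteq> 0" if "z \<in> annulus R" for z using nonzero_annulus[OF R that] .
  consider "infinite {w \<in> sphere 0 r. cmod (h w) = r}"
    | "infinite {w \<in> sphere 0 (1 / r). cmod (h w) = r}"
    using infinite_extremal_2 by (auto simp: r_def)
  then show thesis
  proof cases
    case 1
    then have "cmod (h w) = r" if "cmod w = r" for w
      using unimodular_on_dilated_circle[OF R _ r(2) holomorphic_h _ _ that] r r' by simp
    then have unim: "cmod (h z / z) = 1" if "cmod z = 1 \<or> cmod z = r" for z
      using that norm_h_unit_circle r by (auto simp: norm_divide)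
    have "(\<lambda>z. h z / z) holomorphic_on annulus R"
      using holomorphic_h nz by (intro holomorphic_intros) auto
    then have "\<exists>\<beta>\<in>sphere 0 1. \<forall>z\<in>annulus R. h z / z = \<beta>"
      by (rule annulus_unimodular_constant[OF R _ _ _ r unim]) (use R nz h_nonzero in auto)
    then obtain \<beta> where \<beta>: "cmod \<beta> = 1" "\<forall>z\<in>annulus R. h z / z = \<beta>"
      by (auto simp only: mem_sphere_0)
    show thesis
    proof (rule that(1)[of \<beta>])
      show "h z = \<beta> * z" if "z \<in> annulus R" for z
        using \<beta>(2) nz[OF that] that by (metis nonzero_divide_eq_eq)
    qed (rule \<beta>(1))
  next
    case 2
    then have "cmod (h w) = r" if "cmod w = 1 / r" for w
      using unimodular_on_dilated_circle[OF R r'(1) _ holomorphic_h _ _ that] r r' by simp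
    then have unim: "cmod (h z * z) = 1" if "cmod z = 1 / r \<or> cmod z = 1" for z
      using that norm_h_unit_circle r by (auto simp: norm_mult)
    have "(\<lambda>z. h z * z) holomorphic_on annulus R"
      using holomorphic_h by (intro holomorphic_intros) auto
    then have "\<exists>\<beta>\<in>sphere 0 1. \<forall>z\<in>annulus R. h z * z = \<beta>"
      by (rule annulus_unimodular_constant[OF R _ _ r' R unim]) (use nz h_nonzero in auto)
    then obtain \<beta> where \<beta>: "cmod \<beta> = 1" "\<forall>z\<in>annulus R. h z * z = \<beta>"
      by (auto simp only: mem_sphere_0)
    show thesis
    proof (rule that(2)[of \<beta>])
      show "h z = \<beta> / z" if "z \<in> annulus R" for z
        using \<beta>(2) nz[OF that] that by (metis nonzero_eq_divide_eq)
    qed (rule \<beta>(1))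
  qed
qed

text \<open>The functional sending \<open>f\<close> to \<open>T f w\<close> is contractive by the
  case \<open>n = 1\<close>, where \<open>K_ann R 1\<close> is the circle, and extremal because
  \<open>h w\<close> is unimodular.\<close>

lemma eq_composition_unit_circle:
  assumes f: "f \<in> Hol R" and w: "cmod w = 1"
  shows "T f w = f (h w)"
proof -
  have wA: "w \<in> annulus R" using w R by (simp add: annulus_def)
  interpret circle_functional R "\<lambda>f. T f w"
  proof
    show "sphere 0 1 \<subseteq> annulus R" using R by (intro sphere_subset_annulus) auto
    show "T (ann_ext R (\<lambda>_. 1)) w = 1" using wA by (simp add: unital) (simp add: ann_ext_def)
    show "cmod (T (ann_ext R (\<lambda>z. z)) w) = 1" using norm_h_unit_circle[OF w] by (simp add: h_def)
    show "cmod (T f w) \<le> B"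
      if "f \<in> Hol R" "\<And>z. z \<in> sphere 0 1 \<Longrightarrow> cmod (f z) \<le> B" for f B
      by (rule contractive[of _ 1]) (use that w in \<open>simp_all only: K_ann_1[OF R] order.refl\<close>, simp)
  qed (simp_all add: add scale)
  show ?thesis using eq_eval[OF f] by (simp add: h_def)
qed

lemma classification:
  "\<exists>\<beta>\<in>sphere 0 1. (\<forall>f\<in>Hol R. T f = T_op 1 \<beta> f) \<or> (\<forall>f\<in>Hol R. T f = S_op 1 \<beta> f)"
proof -
  have circ: "w \<in> annulus R" if "cmod w = 1" for w using that R by (simp add: annulus_def)
  show ?thesis
  proof (cases rule: h_cases)
    case (1 \<beta>)
    then have "T f = T_op 1 \<beta> f" if "f \<in> Hol R" for f
      by (intro Hol_eq_of_eq_unit_circle[OF R] maps T_op_in_Hol that)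
        (auto simp: T_op_def eq_composition_unit_circle[OF that] circ)
    with 1(1) show ?thesis by auto
  next
    case (2 \<beta>)
    then have "T f = S_op 1 \<beta> f" if "f \<in> Hol R" for f
      by (intro Hol_eq_of_eq_unit_circle[OF R] maps S_op_in_Hol that R)
        (auto simp: S_op_def eq_composition_unit_circle[OF that] circ)
    with 2(1) show ?thesis by auto
  qed
qed

end

section \<open>Reduction to the unital case\<close>

lemma image_of_one:
  assumes R: "R > 1" and g: "g \<in> Hol R" and norms: "\<And>n. n \<ge> 1 \<Longrightarrow> sup_norm R n g = 1"
  obtains \<alpha> where "cmod \<alpha> = 1" "g = (\<lambda>z. \<alpha> * ann_ext R (\<lambda>_. 1) z)"
proof -
  \<comment> \<open>The norm for \<open>n = 1\<close> is attained on the unit circle, inside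
    \<open>K_ann R 2\<close>, where the norm is again 1; this is an interior maximum.\<close>
  obtain \<xi> where \<xi>: "\<xi> \<in> K_ann R 1" "cmod (g \<xi>) = 1"
    using sup_norm_attained[OF R _ g, of 1] norms[of 1] by auto
  have "R powr (1 / 2) > 1" using R by (intro gr_one_powr) auto
  moreover from this have "1 / R powr (1 / 2) < 1" by (simp add: divide_less_eq_1)
  moreover have \<xi>1: "cmod \<xi> = 1" using \<xi>(1) unfolding K_ann_1[OF R] by simp
  moreover have "cmod (g z) \<le> cmod (g \<xi>)" if "z \<in> K_ann R 2" for z
    using sup_norm_upper[OF R _ g, of 2 z] that norms[of 2] \<xi>(2) by auto
  moreover have "g holomorphic_on annulus R" using g by (simp add: Hol_def)
  ultimately obtain \<alpha> where \<alpha>: "\<And>z. z \<in> annulus R \<Longrightarrow> g z = \<alpha>"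
    using maximum_modulus_K_ann_2[OF R, of g \<xi>] by auto
  show thesis
  proof
    show "cmod \<alpha> = 1" using \<xi>(2) \<xi>1 \<alpha>[of \<xi>] R by (simp add: annulus_def)
    show "g = (\<lambda>z. \<alpha> * ann_ext R (\<lambda>_. 1) z)"
      using \<alpha> g by (auto simp: Hol_def ann_ext_def fun_eq_iff)
  qed
qed

theorem theorem4p1:
  fixes R :: real and T :: "(complex \<Rightarrow> complex) \<Rightarrow> (complex \<Rightarrow> complex)"
  assumes "R > 1"
    and "T \<in> Hol R \<rightarrow> Hol R"
    and "Hol_linear R T"
    and "continuous_map (Hol_topology R) (Hol_topology R) T"
    and "\<And>f n. f \<in> Hol R \<Longrightarrow> n \<ge> 1 \<Longrightarrow> sup_norm R n (T f) = sup_norm R n f"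
  shows "\<exists>\<alpha>\<in>sphere 0 1. \<exists>\<beta>\<in>sphere 0 1.
           (\<forall>f\<in>Hol R. T f = T_op \<alpha> \<beta> f) \<or> (\<forall>f\<in>Hol R. T f = S_op \<alpha> \<beta> f)"
proof -
  let ?one = "ann_ext R (\<lambda>_. 1)"
  have one: "?one \<in> Hol R" by (simp add: ann_ext_in_Hol)
  have "sup_norm R n ?one = 1" if n: "n \<ge> 1" for n
  proof -
    have "sup_norm R n ?one = (SUP z\<in>K_ann R n. 1)"
      unfolding sup_norm_def using K_ann_subset_annulus[OF assms(1) n]
      by (intro SUP_cong) (auto simp: ann_ext_def)
    moreover have "K_ann R n \<noteq> {}" using K_ann_nonempty[OF assms(1) n] by blast
    ultimately show ?thesis by simp
  qed
  then have "sup_norm R n (T ?one) = 1" if "n \<ge> 1" for n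
    using assms(5)[OF one that] that by simp
  moreover have "T ?one \<in> Hol R" using assms(2) one by blast
  ultimately obtain \<alpha> where \<alpha>: "cmod \<alpha> = 1" "T ?one = (\<lambda>z. \<alpha> * ?one z)"
    using image_of_one[OF assms(1)] by blast
  \<comment> \<open>Division by the unimodular \<open>\<alpha>\<close> keeps all norms and makes the
    operator unital.\<close>
  define T' where "T' f = (\<lambda>z. inverse \<alpha> * T f z)" for f
  have "\<alpha> \<noteq> 0" using \<alpha> by auto
  have "unital_isometry R T'"
  proof
    show "T' ?one = ?one" using \<open>\<alpha> \<noteq> 0\<close> by (simp add: T'_def \<alpha>(2) fun_eq_iff)
    show "T' f \<in> Hol R" if "f \<in> Hol R" for f
      unfolding T'_def using assms(2) that by (intro Hol_scale) auto
    show "sup_norm R n (T' f) = sup_norm R n f" if "f \<in> Hol R" "n \<ge> 1" for f n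
      using assms(5)[OF that] \<alpha>(1) by (simp add: sup_norm_def T'_def norm_mult norm_inverse)
  qed (use assms(1,3) in \<open>auto simp: T'_def Hol_linear_def algebra_simps\<close>)
  then obtain \<beta> where \<beta>: "\<beta> \<in> sphere 0 1"
    "(\<forall>f\<in>Hol R. T' f = T_op 1 \<beta> f) \<or> (\<forall>f\<in>Hol R. T' f = S_op 1 \<beta> f)"
    using unital_isometry.classification by blast
  moreover have "T f z = \<alpha> * T' f z" for f z
    using \<open>\<alpha> \<noteq> 0\<close> by (simp add: T'_def)
  ultimately have "(\<forall>f\<in>Hol R. T f = T_op \<alpha> \<beta> f) \<or> (\<forall>f\<in>Hol R. T f = S_op \<alpha> \<beta> f)"
    by (auto simp: T_op_def S_op_def fun_eq_iff)
  moreover have "\<alpha> \<in> sphere 0 1" using \<alpha>(1) by simp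
  ultimately show ?thesis using \<beta>(1) by blast
qed

end
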